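(* Let $G$ be a graph with $n\ge 1$ vertices, and let $H$ be a graph with $p$ vertices, $q$ edges and independence number $\alpha(H)=2$. Let $\alpha=\alpha(G\circ H)$ and write $I(G\circ H;x)=\sum_{k=0}^{\alpha}s_kx^k$. Then: (i) $I(G\circ H;x)$ is $f$-symmetric, where $f(i)=\left(\frac{p(p-1)}{2}-q\right)^{\frac{\alpha}{2}-i}$ for $0\le i\le \alpha$; that is, $s_{\alpha-i}=\left(\frac{p(p-1)}{2}-q\right)^{\frac{\alpha}{2}-i}s_i$ for all $i\in\{0,1,\dots,\lfloor\alpha/2\rfloor\}$. (ii) $I(G\circ H;x)$ is symmetric if and only if $H$ is isomorphic to $K_r-e$ for some $r\ge 2$, where $K_r-e$ denotes the complete graph $K_r$ with one edge removed.
   Context: All graphs are finite, simple, with nonempty vertex set. An independent set of a graph is a set of pairwise non-adjacent vertices; $\alpha(G)$ is the maximum size of an independent set of $G$. If $s_k$ is the number of independent sets of size $k$ in $G$, the independence polynomial is $I(G;x)=\sum_{k=0}^{\alpha(G)}s_kx^k$. The corona $G\circ H$ is the graph obtained from $G$ and $|V(G)|$ disjoint copies of $H$, one copy for each vertex of $G$, by joining each vertex of $G$ to all vertices of its copy of $H$. A polynomial $\sum_{k=0}^{N}a_kx^k$ of degree $N$ is $f$-symmetric if $a_{N-i}=f(i)\,a_i$ for all $i\in\{0,\dots,\lfloor N/2\rfloor\}$, and symmetric if $a_{N-i}=a_i$ for all such $i$. *)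

theory Defs
  imports Complex_Main "HOL-Library.Ramsey" "HOL-Computational_Algebra.Polynomial"
begin

type_synonym 'a graph = "'a set \<times> 'a set set"

abbreviation verts :: "'a graph \<Rightarrow> 'a set"
  where "verts \<equiv> fst"

abbreviation edges :: "'a graph \<Rightarrow> 'a set set"
  where "edges \<equiv> snd"

definition simple_graph :: "'a graph \<Rightarrow> bool"
  where "simple_graph G \<longleftrightarrow> finite (verts G) \<and> verts G \<noteq> {} \<and> edges G \<subseteq> [verts G]\<^bsup>2\<^esup>"

definition independent_sets :: "'a graph \<Rightarrow> 'a set set"
  where "independent_sets G = {S. S \<subseteq> verts G \<and> indep S (edges G)}"

definition independence_number :: "'a graph \<Rightarrow> nat"
  where "independence_number G = Max (card ` independent_sets G)"

definition num_independent :: "'a graph \<Rightarrow> nat \<Rightarrow> nat"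
  where "num_independent G k = card {S \<in> independent_sets G. card S = k}"

definition independence_poly :: "'a graph \<Rightarrow> real poly"
  where "independence_poly G =
    (\<Sum>k = 0..independence_number G. monom (real (num_independent G k)) k)"

text \<open>The vertex \<open>Inr (v, w)\<close> is the vertex \<open>w\<close> in the copy of \<open>H\<close> attached to the vertex \<open>v\<close>
  of \<open>G\<close>.\<close>

definition corona :: "'a graph \<Rightarrow> 'b graph \<Rightarrow> ('a + 'a \<times> 'b) graph"
  where "corona G H =
    (Inl ` verts G \<union> Inr ` (verts G \<times> verts H),
     {Inl ` e | e. e \<in> edges G}
     \<union> {(\<lambda>w. Inr (v, w)) ` e | v e. v \<in> verts G \<and> e \<in> edges H}
     \<union> {{Inl v, Inr (v, w)} | v w. v \<in> verts G \<and> w \<in> verts H})"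

definition graph_iso :: "'a graph \<Rightarrow> 'b graph \<Rightarrow> bool"
  where "graph_iso G H \<longleftrightarrow>
    (\<exists>\<phi>. bij_betw \<phi> (verts G) (verts H) \<and>
      (\<forall>u\<in>verts G. \<forall>v\<in>verts G. {u, v} \<in> edges G \<longleftrightarrow> {\<phi> u, \<phi> v} \<in> edges H))"

definition complete_graph :: "nat \<Rightarrow> nat graph"
  where "complete_graph r = ({..<r}, [{..<r}]\<^bsup>2\<^esup>)"

definition delete_edge :: "'a graph \<Rightarrow> 'a set \<Rightarrow> 'a graph"
  where "delete_edge G e = (verts G, edges G - {e})"

definition f_symmetric :: "(nat \<Rightarrow> real) \<Rightarrow> real poly \<Rightarrow> bool"
  where "f_symmetric f P \<longleftrightarrow>
    (\<forall>i \<in> {0..degree P div 2}. coeff P (degree P - i) = f i * coeff P i)"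

definition symmetric_poly :: "real poly \<Rightarrow> bool"
  where "symmetric_poly P \<longleftrightarrow>
    (\<forall>i \<in> {0..degree P div 2}. coeff P (degree P - i) = coeff P i)"

lemma simple_graph_corona:
  assumes "simple_graph G" "simple_graph H"
  shows "simple_graph (corona G H)"
proof -
  have sub: "e \<subseteq> verts G" "card e = 2" if "e \<in> edges G" for e
    using assms(1) that by (auto simp: simple_graph_def nsets_def)
  have subH: "e \<subseteq> verts H" "card e = 2" if "e \<in> edges H" for e
    using assms(2) that by (auto simp: simple_graph_def nsets_def)
  have fin: "finite e" if "card e = 2" for e :: "'c set"
    using that by (metis card.infinite zero_neq_numeral)
  have 1: "Inl ` e \<in> [verts (corona G H)]\<^bsup>2\<^esup>" if "e \<in> edges G" for e
    using sub[OF that] fin[OF sub(2)[OF that]]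
    by (auto simp: corona_def nsets_def card_image)
  have 2: "(\<lambda>w. Inr (v, w)) ` e \<in> [verts (corona G H)]\<^bsup>2\<^esup>"
    if "v \<in> verts G" "e \<in> edges H" for v e
  proof -
    have "inj_on (\<lambda>w. Inr (v, w) :: 'a + 'a \<times> 'b) e"
      by (auto simp: inj_on_def)
    then have "card ((\<lambda>w. Inr (v, w) :: 'a + 'a \<times> 'b) ` e) = 2"
      using subH(2)[OF that(2)] by (simp add: card_image)
    then show ?thesis
      using subH(1)[OF that(2)] that(1) fin[OF subH(2)[OF that(2)]]
      by (auto simp: corona_def nsets_def)
  qed
  have 3: "{Inl v, Inr (v, w)} \<in> [verts (corona G H)]\<^bsup>2\<^esup>"
    if "v \<in> verts G" "w \<in> verts H" for v w
    using that by (auto simp: corona_def nsets_def)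
  have "edges (corona G H) \<subseteq> [verts (corona G H)]\<^bsup>2\<^esup>"
  proof
    fix e assume "e \<in> edges (corona G H)"
    then show "e \<in> [verts (corona G H)]\<^bsup>2\<^esup>"
      using 1 2 3 by (auto simp: corona_def)
  qed
  moreover have "finite (verts (corona G H))" "verts (corona G H) \<noteq> {}"
    using assms by (auto simp: simple_graph_def corona_def)
  ultimately show ?thesis
    by (simp add: simple_graph_def)
qed

end

theory Submission
  imports Defs
begin

text \<open>An independent set of \<open>corona G H\<close> is an independent set \<open>S\<close> of \<open>G\<close> together with an arbitrary
  independent set in each copy of \<open>H\<close> attached to a vertex outside \<open>S\<close>. Hence its independence
  polynomial is the sum over \<open>S\<close> of \<open>x ^ |S| * B ^ (n - |S|)\<close>, where \<open>B = 1 + p x + m x\<^sup>2\<close> is the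
  independence polynomial of \<open>H\<close> and \<open>m > 0\<close> counts the non-edges of \<open>H\<close>. Substituting \<open>x / sqrt m\<close> for
  \<open>x\<close> makes \<open>B\<close> palindromic, so every summand satisfies the same relation
  \<open>a (2 n - i) = m ^ (n - i) * a i\<close>. Symmetry forces \<open>m ^ n = 1\<close>, that is, exactly one non-edge.\<close>

section \<open>Coefficients and degree of the independence polynomial\<close>

lemma finite_independent_sets: "finite (verts G) \<Longrightarrow> finite (independent_sets G)"
  by (simp add: independent_sets_def)

lemma empty_in_independent_sets: "{} \<in> independent_sets G"
  by (simp add: independent_sets_def indep_def)

lemma card_le_independence_number:
  "finite (verts G) \<Longrightarrow> S \<in> independent_sets G \<Longrightarrow> card S \<le> independence_number G"
  by (simp add: independence_number_def finite_independent_sets)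

lemma maximum_independent_set:
  assumes "finite (verts G)"
  obtains S where "S \<in> independent_sets G" "card S = independence_number G"
proof -
  have "independence_number G \<in> card ` independent_sets G"
    unfolding independence_number_def
    using assms empty_in_independent_sets[of G]
    by (intro Max_in) (auto simp: finite_independent_sets)
  then show thesis using that by auto
qed

lemma num_independent_pos_iff:
  "finite (verts G) \<Longrightarrow> 0 < num_independent G k \<longleftrightarrow> (\<exists>S\<in>independent_sets G. card S = k)"
  by (auto simp: num_independent_def card_gt_0_iff finite_independent_sets)

text \<open>Above the independence number there is no independent set to count, so both sides vanish
  and no bound on \<open>k\<close> has to be carried along.\<close>

lemma coeff_independence_poly:
  assumes "finite (verts G)"
  shows "coeff (independence_poly G) k = real (num_independent G k)"
proof (cases "k \<le> independence_number G")
  case True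
  then show ?thesis
    by (simp add: independence_poly_def coeff_sum if_distrib cong: if_cong)
next
  case False
  then have "num_independent G k = 0"
    using num_independent_pos_iff[OF assms, of k] card_le_independence_number[OF assms] by auto
  then show ?thesis
    using False by (simp add: independence_poly_def coeff_sum)
qed

lemma degree_independence_poly:
  assumes "finite (verts G)"
  shows "degree (independence_poly G) = independence_number G"
proof (rule antisym)
  show "degree (independence_poly G) \<le> independence_number G"
    by (auto simp: independence_poly_def intro!: degree_sum_le order_trans[OF degree_monom_le])
  show "independence_number G \<le> degree (independence_poly G)"
    by (rule le_degree, use maximum_independent_set[OF assms] num_independent_pos_iff[OF assms]
        in \<open>auto simp: coeff_independence_poly[OF assms]\<close>)
qed

text \<open>Ungrouping the sets of equal size gives one monomial per independent set. In this form
  the sum can be reindexed along a bijection and factored.\<close>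

lemma independence_poly_eq_sum:
  assumes "finite (verts G)"
  shows "independence_poly G = (\<Sum>S\<in>independent_sets G. monom 1 (card S))"
proof (rule poly_eqI)
  fix k
  have "(\<Sum>S\<in>independent_sets G. if card S = k then 1 else 0) = real (num_independent G k)"
    by (subst sum.inter_filter[symmetric])
       (simp_all add: num_independent_def assms finite_independent_sets)
  then show "coeff (independence_poly G) k =
      coeff (\<Sum>S\<in>independent_sets G. monom 1 (card S)) k"
    by (simp add: coeff_sum coeff_independence_poly assms)
qed

section \<open>Independent sets with at most two elements\<close>

lemma num_independent_0: "num_independent G 0 = 1" if "finite (verts G)"
proof -
  \<comment> \<open>Infinite sets also have \<open>card\<close> 0; finiteness of the vertex set
    rules them out.\<close>
  have "{S \<in> independent_sets G. card S = 0} = {{}}"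
    using that empty_in_independent_sets
    by (auto simp: independent_sets_def dest: finite_subset)
  then show ?thesis by (simp add: num_independent_def)
qed

lemma num_independent_1: "num_independent G (Suc 0) = card (verts G)"
proof -
  have "{S \<in> independent_sets G. card S = 1} = (\<lambda>v. {v}) ` verts G"
    by (auto simp: independent_sets_def indep_def card_1_singleton_iff)
  then show ?thesis by (simp add: num_independent_def card_image)
qed

lemma independent_pairs: "{S \<in> independent_sets G. card S = 2} = [verts G]\<^bsup>2\<^esup> - edges G"
proof -
  have "S \<in> independent_sets G \<longleftrightarrow> S \<subseteq> verts G \<and> S \<notin> edges G" if "card S = 2" for S
    using that by (auto simp: independent_sets_def indep_def card_2_iff insert_commute)
  then show ?thesis
    by (auto simp: nsets_def intro: card_ge_0_finite)
qed

lemma num_independent_2: "num_independent G 2 = card ([verts G]\<^bsup>2\<^esup> - edges G)"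
  by (simp add: num_independent_def independent_pairs)

text \<open>Identifies the base of the power in the theorem as the number of non-edges: all pairs of
  vertices minus the edges.\<close>

lemma real_num_independent_2:
  assumes "simple_graph G"
  shows "real (num_independent G 2) =
    real (card (verts G)) * (real (card (verts G)) - 1) / 2 - real (card (edges G))"
proof -
  have fin: "finite (verts G)" and sub: "edges G \<subseteq> [verts G]\<^bsup>2\<^esup>"
    using assms by (auto simp: simple_graph_def)
  have finn: "finite ([verts G]\<^bsup>2\<^esup>)" using fin by (simp add: finite_imp_finite_nsets)
  \<comment> \<open>This keeps the subtraction of natural numbers from truncating when it is moved
    to the reals.\<close>
  have "card (edges G) \<le> card ([verts G]\<^bsup>2\<^esup>)" by (rule card_mono[OF finn sub])
  then have "real (num_independent G 2) = real (card ([verts G]\<^bsup>2\<^esup>)) - real (card (edges G))"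
    using sub finn by (simp add: num_independent_2 card_Diff_subset finite_subset of_nat_diff)
  also have "real (card ([verts G]\<^bsup>2\<^esup>)) = real (card (verts G) choose 2)"
    by (simp add: card_nsets)
  also have "\<dots> = real (card (verts G)) * (real (card (verts G)) - 1) / 2"
    by (cases "card (verts G)") (auto simp: choose_two real_of_nat_div algebra_simps)
  finally show ?thesis .
qed

lemma independence_poly_quadratic:
  assumes "finite (verts H)" "independence_number H = 2"
  shows "independence_poly H = [:1, real (card (verts H)), real (num_independent H 2):]"
proof (rule poly_eqI)
  fix k :: nat
  consider "k = 0" | "k = 1" | "k = 2" | "k > 2" by linarith
  then show "coeff (independence_poly H) k =
    coeff [:1, real (card (verts H)), real (num_independent H 2):] k"
  proof cases
    case 4
    then have "coeff (independence_poly H) k = 0"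
      by (intro coeff_eq_0) (simp add: degree_independence_poly assms)
    with 4 show ?thesis by (simp add: coeff_eq_0)
  qed (simp_all add: coeff_independence_poly assms num_independent_0 num_independent_1
        numeral_2_eq_2)
qed

section \<open>Independent sets of the corona\<close>

text \<open>Decides adjacency by the constructors of the two endpoints. The mixed case is given in
  both orders, so that it rewrites whichever endpoint comes first.\<close>

lemma edges_corona_simps:
  "{Inl u, Inl v} \<in> edges (corona G H) \<longleftrightarrow> {u, v} \<in> edges G"
  "{Inr (u, x), Inr (v, y)} \<in> edges (corona G H) \<longleftrightarrow>
     u = v \<and> v \<in> verts G \<and> {x, y} \<in> edges H"
  "{Inl u, Inr (v, y)} \<in> edges (corona G H) \<longleftrightarrow> u = v \<and> v \<in> verts G \<and> y \<in> verts H"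
  "{Inr (v, y), Inl u} \<in> edges (corona G H) \<longleftrightarrow> u = v \<and> v \<in> verts G \<and> y \<in> verts H"
proof -
  have LL: "{Inl u, Inl v} = (Inl ` e :: ('a + 'a \<times> 'b) set) \<longleftrightarrow> e = {u, v}" for e
    by (metis image_empty image_insert inj_Inl inj_image_eq_iff)
  \<comment> \<open>All elements of the image carry the label \<open>z\<close>, which fixes
    \<open>u\<close> and \<open>v\<close>; injectivity for this fixed label then recovers
    \<open>e\<close>.\<close>
  have RR: "{Inr (u, x), Inr (v, y)} = ((\<lambda>w. Inr (z, w)) ` e :: ('a + 'a \<times> 'b) set) \<longleftrightarrow>
      u = z \<and> v = z \<and> e = {x, y}" for z e
  proof
    assume *: "{Inr (u, x), Inr (v, y)} = ((\<lambda>w. Inr (z, w)) ` e :: ('a + 'a \<times> 'b) set)"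
    then have z: "u = z" "v = z" by blast+
    have "inj (\<lambda>w. Inr (z, w) :: 'a + 'a \<times> 'b)" by (simp add: inj_on_def)
    moreover have "(\<lambda>w. Inr (z, w) :: 'a + 'a \<times> 'b) ` e = (\<lambda>w. Inr (z, w)) ` {x, y}"
      using * z by simp
    ultimately have "e = {x, y}" by (simp only: inj_image_eq_iff)
    with z show "u = z \<and> v = z \<and> e = {x, y}" by simp
  qed auto
  show "{Inl u, Inl v} \<in> edges (corona G H) \<longleftrightarrow> {u, v} \<in> edges G"
    by (auto simp: corona_def LL doubleton_eq_iff)
  show "{Inr (u, x), Inr (v, y)} \<in> edges (corona G H) \<longleftrightarrow>
     u = v \<and> v \<in> verts G \<and> {x, y} \<in> edges H"
    by (auto simp: corona_def RR doubleton_eq_iff)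
  show LR: "{Inl u, Inr (v, y)} \<in> edges (corona G H) \<longleftrightarrow> u = v \<and> v \<in> verts G \<and> y \<in> verts H"
    by (auto simp: corona_def doubleton_eq_iff)
  show "{Inr (v, y), Inl u} \<in> edges (corona G H) \<longleftrightarrow> u = v \<and> v \<in> verts G \<and> y \<in> verts H"
    using LR by (simp add: insert_commute)
qed

text \<open>Different copies of \<open>H\<close> are not joined to each other, so the fibers are
  constrained one at a time. The edges from \<open>v\<close> to its own copy force the fiber over
  \<open>v\<close> to be empty once \<open>v\<close> is chosen.\<close>

lemma independent_sets_corona_iff:
  fixes G :: "'a graph" and H :: "'b graph"
  defines "fiber \<equiv> \<lambda>T v. {w. Inr (v, w) \<in> T}"
  shows "T \<in> independent_sets (corona G H) \<longleftrightarrow>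
    Inl -` T \<in> independent_sets G \<and> (\<forall>v. fiber T v \<in> independent_sets H) \<and>
    (\<forall>v. fiber T v \<noteq> {} \<longrightarrow> v \<in> verts G - Inl -` T)"
    (is "?L \<longleftrightarrow> ?R")
proof
  assume ?L
  then have sub: "T \<subseteq> Inl ` verts G \<union> Inr ` (verts G \<times> verts H)"
    and ind: "\<And>a b. a \<in> T \<Longrightarrow> b \<in> T \<Longrightarrow> a \<noteq> b \<Longrightarrow> {a, b} \<notin> edges (corona G H)"
    by (auto simp: independent_sets_def indep_def corona_def)
  have R: "v \<in> verts G" "w \<in> verts H" if "Inr (v, w) \<in> T" for v w
    using sub that by auto
  have "Inl -` T \<in> independent_sets G"
    using sub ind[of "Inl _" "Inl _"]
    by (auto simp: independent_sets_def indep_def edges_corona_simps)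
  moreover have "fiber T v \<in> independent_sets H" for v
    using R ind[of "Inr (v, _)" "Inr (v, _)"]
    by (auto simp: fiber_def independent_sets_def indep_def edges_corona_simps)
  moreover have "v \<in> verts G - Inl -` T" if "fiber T v \<noteq> {}" for v
    using that R ind[of "Inl v" "Inr (v, _)"]
    by (auto simp: fiber_def edges_corona_simps)
  ultimately show ?R by blast
next
  assume ?R
  then have ind: "\<And>u v. Inl u \<in> T \<Longrightarrow> Inl v \<in> T \<Longrightarrow> u \<noteq> v \<Longrightarrow> {u, v} \<notin> edges G"
    "\<And>v x y. Inr (v, x) \<in> T \<Longrightarrow> Inr (v, y) \<in> T \<Longrightarrow> x \<noteq> y \<Longrightarrow> {x, y} \<notin> edges H"
    and sub: "\<And>v. Inl v \<in> T \<Longrightarrow> v \<in> verts G"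
    "\<And>v w. Inr (v, w) \<in> T \<Longrightarrow> v \<in> verts G \<and> w \<in> verts H \<and> Inl v \<notin> T"
    by (auto simp: fiber_def independent_sets_def indep_def)
  have "a \<in> Inl ` verts G \<union> Inr ` (verts G \<times> verts H)" if "a \<in> T" for a
    using that sub by (cases a) auto
  moreover have "{a, b} \<notin> edges (corona G H)" if "a \<in> T" "b \<in> T" "a \<noteq> b" for a b
  proof (cases a; cases b)
    fix y z assume "a = Inr y" "b = Inr z"
    then show ?thesis
      using that ind(2) by (cases y; cases z) (auto simp: edges_corona_simps)
  qed (use that sub ind(1) in \<open>auto simp: edges_corona_simps\<close>)
  ultimately show ?L
    by (auto simp: independent_sets_def indep_def corona_def[of G H])
qed

text \<open>Independent sets \<open>T\<close> correspond to pairs of a trace \<open>S\<close> on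
  \<open>G\<close> and a choice of an independent set of \<open>H\<close> for each vertex outside
  \<open>S\<close>. For fixed \<open>S\<close> these choices are independent, so each such vertex
  contributes one factor \<open>independence_poly H\<close>.\<close>

lemma independence_poly_corona:
  fixes G :: "'a graph" and H :: "'b graph"
  assumes "finite (verts G)" "finite (verts H)"
  shows "independence_poly (corona G H) =
    (\<Sum>S\<in>independent_sets G. monom 1 (card S) * independence_poly H ^ (card (verts G) - card S))"
proof -
  let ?V = "verts G" and ?I = "independent_sets H"
  let ?glue = "\<lambda>(S, g). Inl ` S \<union> Inr ` Sigma (?V - S) g :: ('a + 'a \<times> 'b) set"
  \<comment> \<open>Restricting the fiber function to the vertices outside the trace makes it
    extensional, so that each \<open>T\<close> comes from exactly one pair.\<close>
  let ?split = "\<lambda>T. (Inl -` T, \<lambda>v \<in> ?V - Inl -` T. {w. Inr (v, w) \<in> T})"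
  let ?X = "SIGMA S:independent_sets G. (?V - S) \<rightarrow>\<^sub>E ?I"
  have "finite (verts (corona G H))" using assms by (simp add: corona_def)
  then have "independence_poly (corona G H) =
      (\<Sum>T\<in>independent_sets (corona G H). monom 1 (card T))"
    by (rule independence_poly_eq_sum)
  also have "\<dots> = (\<Sum>(S, g)\<in>?X. monom 1 (card S) * (\<Prod>v\<in>?V - S. monom 1 (card (g v))))"
  proof (rule sum.reindex_bij_witness[where i = ?glue and j = ?split])
    fix T assume "T \<in> independent_sets (corona G H)"
    note T = this[unfolded independent_sets_corona_iff]
    show "?split T \<in> ?X" using T by auto
    have eq: "a \<in> ?glue (?split T) \<longleftrightarrow> a \<in> T" for a
      using T by (cases a) auto
    then show glue: "?glue (?split T) = T" by blast
    define S where "S = Inl -` T"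
    define g where "g v = {w. Inr (v, w) \<in> T}" for v
    have S: "finite S" "S \<subseteq> ?V"
      using T assms by (auto simp: S_def independent_sets_def intro: finite_subset)
    have g: "finite (g v)" for v
    proof (rule finite_subset[OF _ assms(2)])
      show "g v \<subseteq> verts H" using T by (auto simp: g_def independent_sets_def)
    qed
    have Teq: "T = Inl ` S \<union> Inr ` Sigma (?V - S) g"
    proof (rule set_eqI)
      fix a show "a \<in> T \<longleftrightarrow> a \<in> Inl ` S \<union> Inr ` Sigma (?V - S) g"
        using T by (cases a) (auto simp: S_def g_def)
    qed
    have "card T = card (Inl ` S :: ('a + 'a \<times> 'b) set)
        + card (Inr ` Sigma (?V - S) g :: ('a + 'a \<times> 'b) set)"
      unfolding Teq using S g assms by (intro card_Un_disjoint) auto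
    also have "\<dots> = card S + (\<Sum>v\<in>?V - S. card (g v))"
      using g assms by (simp add: card_image)
    finally have c: "card T = card S + (\<Sum>v\<in>?V - S. card (g v))" .
    have "(\<Prod>v\<in>A. monom (1 :: real) (card (g v))) = monom 1 (\<Sum>v\<in>A. card (g v))"
      if "finite A" for A
      using that by (induction A rule: finite_induct) (auto simp: mult_monom)
    then show "(case ?split T of (S, g) \<Rightarrow>
        monom 1 (card S) * (\<Prod>v\<in>?V - S. monom 1 (card (g v)))) = monom (1 :: real) (card T)"
      using assms by (simp add: c mult_monom flip: S_def g_def)
  next
    fix Y assume "Y \<in> ?X"
    then obtain S g where Y: "Y = (S, g)" and S: "S \<in> independent_sets G"
      and g: "g \<in> (?V - S) \<rightarrow>\<^sub>E ?I" by auto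
    have fiber: "{w. Inr (v, w) \<in> ?glue Y} = (if v \<in> ?V - S then g v else {})" for v
      by (auto simp: Y)
    have base: "Inl -` ?glue Y = S" by (auto simp: Y)
    show "?glue Y \<in> independent_sets (corona G H)"
      unfolding independent_sets_corona_iff fiber base
      using S g by (auto simp: empty_in_independent_sets)
    show "?split (?glue Y) = Y"
      unfolding fiber base using g by (auto simp: Y fun_eq_iff PiE_def extensional_def)
  qed
  also have "\<dots> = (\<Sum>S\<in>independent_sets G. monom 1 (card S) *
      (\<Sum>g\<in>(?V - S) \<rightarrow>\<^sub>E ?I. \<Prod>v\<in>?V - S. monom 1 (card (g v))))"
    using assms
    by (simp add: sum_distrib_left finite_independent_sets finite_PiE flip: sum.Sigma)
  also have "\<dots> = (\<Sum>S\<in>independent_sets G. monom 1 (card S) * independence_poly H ^ (card ?V - card S))"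
  proof (rule sum.cong[OF refl])
    fix S assume "S \<in> independent_sets G"
    then have "S \<subseteq> ?V" by (simp add: independent_sets_def)
    then have "card (?V - S) = card ?V - card S"
      using assms by (simp add: card_Diff_subset finite_subset)
    \<comment> \<open>Distributivity: a product over vertices of sums over independent sets expands
      into a sum over choice functions.\<close>
    then show "monom 1 (card S) * (\<Sum>g\<in>(?V - S) \<rightarrow>\<^sub>E ?I. \<Prod>v\<in>?V - S. monom 1 (card (g v))) =
        monom 1 (card S) * independence_poly H ^ (card ?V - card S)"
      using assms prod_sum_PiE[of "?V - S" "\<lambda>_. ?I" "\<lambda>_ T. monom (1 :: real) (card T)"]
      by (simp add: finite_independent_sets independence_poly_eq_sum)
  qed
  finally show ?thesis .
qed

section \<open>Coefficient relations for powers of a quadratic\<close>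

text \<open>The quadratic is \<open>B\<close> evaluated at \<open>t * x\<close> with
  \<open>B\<close> palindromic and \<open>t = sqrt m\<close>. Rescaling multiplies coefficient
  \<open>j\<close> by \<open>t ^ j\<close>, so opposite coefficients differ by the factor
  \<open>t ^ (2 * N - 2 * i) = m ^ (N - i)\<close>.\<close>

lemma coeff_quadratic_power_symmetric:
  fixes p m :: real
  assumes "m > 0" "i \<le> N"
  shows "coeff ([:1, p, m:] ^ N) (2 * N - i) = m ^ (N - i) * coeff ([:1, p, m:] ^ N) i"
proof -
  define t where "t = sqrt m"
  have t: "t > 0" "t * t = m" using assms by (auto simp: t_def)
  \<comment> \<open>The middle coefficient is divided by \<open>t\<close> so that rescaling restores
    \<open>p\<close>; the outer coefficients become equal because \<open>t * t = m\<close>.\<close>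
  define B where "B = [:1, p / t, 1:]"
  have B: "[:1, p, m:] = pcompose B [:0, t:]"
    using t by (simp add: B_def pcompose_pCons)
  have "pcompose B [:0, t:] ^ N = pcompose (B ^ N) [:0, t:]"
    by (induction N) (simp_all add: pcompose_mult pcompose_1)
  then have c: "coeff ([:1, p, m:] ^ N) j = t ^ j * coeff (B ^ N) j" for j
    by (simp add: B coeff_pcompose_linear)
  have deg: "degree (B ^ N) = 2 * N" by (simp add: degree_power_eq B_def)
  \<comment> \<open>Reversal of coefficients is multiplicative, so powers of a palindromic
    polynomial are palindromic.\<close>
  have "reflect_poly B = B" by (simp add: B_def reflect_poly_def)
  then have "reflect_poly (B ^ N) = B ^ N" by (simp add: reflect_poly_power)
  then have "coeff (B ^ N) (2 * N - i) = coeff (B ^ N) i"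
    using assms(2) deg by (metis coeff_reflect_poly not_le trans_le_add1 mult_2)
  moreover have "t ^ (2 * N - i) = m ^ (N - i) * t ^ i"
  proof -
    have "2 * N - i = (N - i) + (N - i) + i" using assms by simp
    then have "t ^ (2 * N - i) = t ^ (N - i) * t ^ (N - i) * t ^ i" by (simp only: power_add)
    then show ?thesis by (simp add: t(2)[symmetric] power_mult_distrib)
  qed
  ultimately show ?thesis by (simp add: c)
qed

text \<open>The power has centre \<open>n - k\<close>, and multiplication by the monomial shifts it
  to \<open>n\<close>. The factor \<open>m ^ (n - i)\<close> is therefore free of \<open>k\<close>,
  which is what allows summands with different \<open>k\<close> to be added.\<close>

lemma coeff_monom_quadratic_power_symmetric:
  fixes p m :: real
  assumes "m > 0" "i \<le> n" "k \<le> n"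
  shows "coeff (monom 1 k * [:1, p, m:] ^ (n - k)) (2 * n - i) =
    m ^ (n - i) * coeff (monom 1 k * [:1, p, m:] ^ (n - k)) i"
proof (cases "i < k")
  case True
  \<comment> \<open>For \<open>i < k\<close> both coefficients vanish: index \<open>i\<close> lies
    below the monomial, and \<open>2 * n - i - k\<close> exceeds the degree bound
    \<open>2 * (n - k)\<close>.\<close>
  have "degree ([:1, p, m:] ^ (n - k)) \<le> 2 * (n - k)"
    using degree_power_le[of "[:1, p, m:]" "n - k"] assms(1) by simp
  then have "coeff ([:1, p, m:] ^ (n - k)) (2 * n - i - k) = 0"
    using True assms by (intro coeff_eq_0) linarith
  with True assms show ?thesis by (simp add: coeff_monom_mult)
next
  case False
  then have "2 * n - i - k = 2 * (n - k) - (i - k)" "n - k - (i - k) = n - i"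
    using assms by linarith+
  with False assms coeff_quadratic_power_symmetric[OF assms(1), of "i - k" "n - k" p]
  show ?thesis by (simp add: coeff_monom_mult)
qed

section \<open>Graphs with exactly one non-edge\<close>

text \<open>The vertex bijection acts on pairs by taking images; this action is a bijection that
  respects edges, hence also non-edges.\<close>

lemma card_nonedges_iso:
  assumes "graph_iso H K"
  shows "card ([verts H]\<^bsup>2\<^esup> - edges H) = card ([verts K]\<^bsup>2\<^esup> - edges K)"
proof -
  obtain \<phi> where bij: "bij_betw \<phi> (verts H) (verts K)"
    and \<phi>: "\<And>u v. u \<in> verts H \<Longrightarrow> v \<in> verts H \<Longrightarrow> {u, v} \<in> edges H \<longleftrightarrow> {\<phi> u, \<phi> v} \<in> edges K"
    using assms by (auto simp: graph_iso_def)
  have "bij_betw ((`) \<phi>) ([verts H]\<^bsup>2\<^esup>) ([verts K]\<^bsup>2\<^esup>)" using bij by (rule bij_betw_nsets)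
  moreover have "\<phi> ` e \<in> edges K \<longleftrightarrow> e \<in> edges H" if "e \<in> [verts H]\<^bsup>2\<^esup>" for e
    using that \<phi> by (auto elim!: nsets2_E)
  then have "(`) \<phi> ` ([verts H]\<^bsup>2\<^esup> - edges H) = (`) \<phi> ` [verts H]\<^bsup>2\<^esup> - edges K"
    by blast
  ultimately have "bij_betw ((`) \<phi>) ([verts H]\<^bsup>2\<^esup> - edges H) ([verts K]\<^bsup>2\<^esup> - edges K)"
    by (simp add: bij_betw_def inj_on_diff)
  then show ?thesis by (rule bij_betw_same_card)
qed

text \<open>A complete graph minus an edge has one non-edge, and isomorphism preserves that count.
  Conversely, if \<open>e\<close> is the only non-edge, any numbering of the vertices is an
  isomorphism onto the complete graph minus the image of \<open>e\<close>.\<close>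

lemma iso_complete_minus_edge_iff:
  assumes "simple_graph H"
  shows "(\<exists>r \<ge> 2. \<exists>e \<in> edges (complete_graph r).
      graph_iso H (delete_edge (complete_graph r) e)) \<longleftrightarrow> num_independent H 2 = 1"
    (is "?L \<longleftrightarrow> ?R")
proof
  assume ?L
  then obtain r e where e: "e \<in> [{..<r}]\<^bsup>2\<^esup>"
    and iso: "graph_iso H (delete_edge (complete_graph r) e)"
    by (auto simp: complete_graph_def)
  have "[{..<r}]\<^bsup>2\<^esup> - ([{..<r}]\<^bsup>2\<^esup> - {e}) = {e}" using e by blast
  then show ?R
    using card_nonedges_iso[OF iso]
    by (simp add: num_independent_2 delete_edge_def complete_graph_def)
next
  assume ?R
  then obtain e where e: "[verts H]\<^bsup>2\<^esup> - edges H = {e}"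
    by (auto simp: num_independent_2 card_1_singleton_iff)
  let ?r = "card (verts H)"
  have fin: "finite (verts H)" using assms by (simp add: simple_graph_def)
  obtain \<phi> where bij: "bij_betw \<phi> (verts H) {..<?r}"
    using ex_bij_betw_finite_nat[OF fin] by (auto simp: atLeast0LessThan)
  have e2: "e \<in> [verts H]\<^bsup>2\<^esup>" using e by blast
  then have "2 \<le> ?r" using card_mono[OF fin, of e] by (simp add: nsets_def)
  have im: "bij_betw ((`) \<phi>) ([verts H]\<^bsup>2\<^esup>) ([{..<?r}]\<^bsup>2\<^esup>)" using bij by (rule bij_betw_nsets)
  then have e': "\<phi> ` e \<in> edges (complete_graph ?r)"
    using e2 by (auto simp: complete_graph_def bij_betw_def)
  have "{u, v} \<in> edges H \<longleftrightarrow> {\<phi> u, \<phi> v} \<in> [{..<?r}]\<^bsup>2\<^esup> - {\<phi> ` e}"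
    if uv: "u \<in> verts H" "v \<in> verts H" for u v
  proof (cases "u = v")
    \<comment> \<open>\<open>graph_iso\<close> also compares \<open>u\<close> with itself; both
      sides are then false, since a singleton is not a two-element set.\<close>
    case True
    moreover have "{u, u} \<notin> edges H"
      using assms doubleton_in_nsets_2[of u u "verts H"] by (auto simp: simple_graph_def)
    ultimately show ?thesis by (metis DiffE doubleton_in_nsets_2)
  next
    case False
    then have uv2: "{u, v} \<in> [verts H]\<^bsup>2\<^esup>" using uv by simp
    have "{u, v} \<in> edges H \<longleftrightarrow> {u, v} \<notin> [verts H]\<^bsup>2\<^esup> - edges H" using uv2 by simp
    also have "\<dots> \<longleftrightarrow> {u, v} \<noteq> e" by (simp add: e)
    also have "\<dots> \<longleftrightarrow> \<phi> ` {u, v} \<noteq> \<phi> ` e"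
      using inj_on_eq_iff[OF bij_betw_imp_inj_on[OF im] uv2 e2] by simp
    finally have "{u, v} \<in> edges H \<longleftrightarrow> \<phi> ` {u, v} \<noteq> \<phi> ` e" .
    moreover have "\<phi> ` {u, v} \<in> [{..<?r}]\<^bsup>2\<^esup>" using bij_betwE[OF im] uv2 by blast
    ultimately show ?thesis by simp
  qed
  then have "graph_iso H (delete_edge (complete_graph ?r) (\<phi> ` e))"
    using bij by (auto simp: graph_iso_def delete_edge_def complete_graph_def)
  with e' \<open>2 \<le> ?r\<close> show ?L by blast
qed

section \<open>Coefficient relation and independence number of the corona\<close>

lemma num_independent_2_pos:
  assumes "simple_graph H" "independence_number H = 2"
  shows "num_independent H 2 > 0"
proof -
  have "finite (verts H)" using assms by (simp add: simple_graph_def)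
  then show ?thesis
    using maximum_independent_set[of H] assms by (auto simp: num_independent_pos_iff)
qed

text \<open>Every summand of the corona formula satisfies the relation with the same factor, and the
  relation is linear in the polynomial.\<close>

lemma coeff_independence_poly_corona_symmetric:
  assumes G: "simple_graph G" and H: "simple_graph H" and H2: "independence_number H = 2"
    and i: "i \<le> card (verts G)"
  shows "coeff (independence_poly (corona G H)) (2 * card (verts G) - i) =
    real (num_independent H 2) ^ (card (verts G) - i) * coeff (independence_poly (corona G H)) i"
proof -
  have fin: "finite (verts G)" "finite (verts H)" using G H by (auto simp: simple_graph_def)
  have "card S \<le> card (verts G)" if "S \<in> independent_sets G" for S
    using that fin by (auto simp: independent_sets_def intro: card_mono)
  then show ?thesis
    using i num_independent_2_pos[OF H H2]
    by (simp add: independence_poly_corona fin independence_poly_quadratic H2 coeff_sum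
        sum_distrib_left coeff_monom_quadratic_power_symmetric)
qed

text \<open>Read off as a degree. A summand has degree at most
  \<open>card S + 2 * (n - card S)\<close>, with \<open>n\<close> the number of vertices of
  \<open>G\<close>, hence at most \<open>2 * n\<close>; the coefficient relation shows that this
  bound is attained.\<close>

lemma independence_number_corona:
  assumes G: "simple_graph G" and H: "simple_graph H" and H2: "independence_number H = 2"
  shows "independence_number (corona G H) = 2 * card (verts G)"
proof -
  let ?n = "card (verts G)" and ?m = "real (num_independent H 2)"
  let ?P = "independence_poly (corona G H)"
  have fin: "finite (verts G)" "finite (verts H)" using G H by (auto simp: simple_graph_def)
  have finc: "finite (verts (corona G H))"
    using simple_graph_corona[OF G H] by (simp add: simple_graph_def)
  \<comment> \<open>The relation at \<open>i = 0\<close> turns the constant coefficient 1 into the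
    \<open>n\<close>-th power of the positive number of non-edges.\<close>
  have "coeff ?P (2 * ?n) \<noteq> 0"
    using coeff_independence_poly_corona_symmetric[OF G H H2, of 0] num_independent_2_pos[OF H H2]
    by (simp add: coeff_independence_poly finc num_independent_0)
  then have "2 * ?n \<le> degree ?P" by (rule le_degree)
  moreover have "degree ?P \<le> 2 * ?n"
    unfolding independence_poly_corona[OF fin]
  proof (rule degree_sum_le)
    fix S assume "S \<in> independent_sets G"
    then have S: "card S \<le> ?n" using fin by (auto simp: independent_sets_def intro: card_mono)
    have "degree (monom 1 (card S) * independence_poly H ^ (?n - card S)) \<le>
        card S + degree (independence_poly H) * (?n - card S)"
      by (rule order_trans[OF degree_mult_le add_mono[OF degree_monom_le degree_power_le]])
    also have "\<dots> \<le> 2 * ?n" using S by (simp add: degree_independence_poly fin H2)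
    finally show "degree (monom 1 (card S) * independence_poly H ^ (?n - card S)) \<le> 2 * ?n" .
  qed (simp add: fin finite_independent_sets)
  ultimately show ?thesis by (simp add: degree_independence_poly finc)
qed

theorem theorem2p3:
  fixes G :: "'a graph" and H :: "'b graph" and n p q \<alpha> :: nat and s :: "nat \<Rightarrow> nat"
  assumes "simple_graph G" and "card (verts G) = n" and "n \<ge> 1"
    and "simple_graph H" and "card (verts H) = p" and "card (edges H) = q"
    and "independence_number H = 2"
  defines "\<alpha> \<equiv> independence_number (corona G H)"
    and "s \<equiv> num_independent (corona G H)"
  shows "f_symmetric (\<lambda>i. (real p * (real p - 1) / 2 - real q) powr (real \<alpha> / 2 - real i))
           (independence_poly (corona G H)) \<and>
         (\<forall>i \<in> {0..\<alpha> div 2}.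
           real (s (\<alpha> - i)) =
             (real p * (real p - 1) / 2 - real q) powr (real \<alpha> / 2 - real i) * real (s i)) \<and>
         (symmetric_poly (independence_poly (corona G H)) \<longleftrightarrow>
           (\<exists>r \<ge> 2. \<exists>e \<in> edges (complete_graph r).
             graph_iso H (delete_edge (complete_graph r) e)))"
proof -
  define m where "m = num_independent H 2"
  let ?P = "independence_poly (corona G H)"
  have m: "real p * (real p - 1) / 2 - real q = real m"
    using real_num_independent_2[OF assms(4)] assms(5,6) by (simp add: m_def)
  have mpos: "m > 0" using num_independent_2_pos[OF assms(4,7)] by (simp add: m_def)
  have \<alpha>: "\<alpha> = 2 * n" using independence_number_corona[OF assms(1,4,7)] assms(2) by (simp add: \<alpha>_def)
  have finc: "finite (verts (corona G H))"
    using simple_graph_corona[OF assms(1,4)] by (simp add: simple_graph_def)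
  have deg: "degree ?P = \<alpha>" by (simp add: degree_independence_poly finc \<alpha>_def)
  have coeff: "coeff ?P k = real (s k)" for k
    by (simp add: s_def coeff_independence_poly finc)
  have pow: "real (s (2 * n - i)) = real m ^ (n - i) * real (s i)" if "i \<le> n" for i
    using coeff_independence_poly_corona_symmetric[OF assms(1,4,7), of i] that assms(2)
    by (simp add: coeff m_def)
  \<comment> \<open>As \<alpha> is even, the exponent is the natural number \<open>n - i\<close>,
    and for a positive base \<open>powr\<close> agrees with the ordinary power.\<close>
  have powr: "real m powr (real \<alpha> / 2 - real i) = real m ^ (n - i)" if "i \<le> n" for i
    using that mpos by (simp add: \<alpha> powr_realpow[symmetric])
  have sym: "\<forall>i \<in> {0..\<alpha> div 2}. real (s (\<alpha> - i)) = real m powr (real \<alpha> / 2 - real i) * real (s i)"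
    using pow powr by (simp add: \<alpha>)
  moreover have "symmetric_poly ?P \<longleftrightarrow> m = 1"
  proof
    assume "symmetric_poly ?P"
    \<comment> \<open>The outermost pair of coefficients already suffices: symmetry makes it equal,
      while the relation gives the ratio \<open>m ^ n\<close>.\<close>
    then have "s (2 * n) = s 0" by (auto simp: symmetric_poly_def deg coeff \<alpha> dest!: bspec[of _ _ 0])
    moreover have "s 0 = 1" by (simp add: s_def num_independent_0 finc)
    ultimately have "real m ^ n = 1" using pow[of 0] by simp
    \<comment> \<open>Here \<open>n \<ge> 1\<close> matters, since for exponent 0 the equation would
      say nothing about \<open>m\<close>.\<close>
    then show "m = 1"
      using mpos \<open>n \<ge> 1\<close> by (simp add: power_eq_1_iff flip: of_nat_power)
  next
    assume "m = 1"
    then show "symmetric_poly ?P" using sym by (simp add: symmetric_poly_def deg coeff)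
  qed
  ultimately show ?thesis
    using iso_complete_minus_edge_iff[OF assms(4)]
    by (simp add: f_symmetric_def deg coeff m m_def[symmetric])
qed

end
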